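(* Let $Q$ be a nonzero commutative unital ring, let $n$ be a positive integer, let $\mathbf w=(w_1,\ldots,w_n)\in\mathbb Z_{\ge1}^n$ and let $k$ be a positive integer. Let $P_{\mathbf w}=Q[x_1,\ldots,x_n]$ be graded by $\deg x_i=w_i$. Then $P_{\mathbf w}^{(kd_{\mathbf w})}$ is generated in degree $1$ if and only if there is no $\mathbf w$-bubble $\mathbf u$ with $d_{\mathbf w}\mid\mathbf w\cdot\mathbf u$ such that the triple $(\mathbf w,\mathbf u,k)$ satisfies the following condition: there exist vectors $\mathbf v_1,\ldots,\mathbf v_r\in V_{\mathbf w}(d_{\mathbf w})$, where $m:=\max\left(1,\left\lceil\left\lfloor\frac{\mathbf w\cdot\mathbf u}{d_{\mathbf w}}\right\rfloor/k\right\rceil\right)$ and $r:=mk-\left\lfloor\frac{\mathbf w\cdot\mathbf u}{d_{\mathbf w}}\right\rfloor$, such that $$\mathbf u+\mathbf v_1+\ldots+\mathbf v_r\notin mV_{\mathbf w}^+(kd_{\mathbf w}).$$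
   Context: Notation: $d_{\mathbf w}=\operatorname{lcm}(w_1,\ldots,w_n)$; $\mathbf a\cdot\mathbf b=\sum_ia_ib_i$; $\mathbf a\preceq\mathbf b$ means $a_i\le b_i$ for all $i$. For a positive integer $m$: $V_{\mathbf w}(m)=\{\mathbf v\in\mathbb Z_{\ge0}^n\mid\mathbf w\cdot\mathbf v=m\}$ and $V^+_{\mathbf w}(m)=\{\mathbf v\in\mathbb Z_{\ge0}^n\mid\mathbf w\cdot\mathbf v\ge m\}$. For $S\subseteq\mathbb Z_{\ge0}^n$ and a positive integer $m$, $mS$ is the Minkowski sum $S+\ldots+S$ with $m$ summands. A $\mathbf w$-bubble is an element $\mathbf u\in\mathbb Z_{\ge0}^n$ such that $\mathbf w\cdot\mathbf u\ge2d_{\mathbf w}$ and there is no $\mathbf v\in\mathbb Z_{\ge0}^n$ with $\mathbf w\cdot\mathbf v=d_{\mathbf w}$ and $\mathbf v\preceq\mathbf u$. For a $\mathbb Z_{\ge0}$-graded ring $S$ and an integer $r\ge1$, the $r$th Veronese subring is $S^{(r)}:=\bigoplus_{m\ge0}S_{rm}$, where $S_{rm}$ is the $m$th graded component of $S^{(r)}$. A graded ring $S$ is generated in degree $1$ if $S=S_0\oplus\bigoplus_{m\ge1}S_1^m$, where $S_1^m$ is the additive subgroup generated by $m$-fold products of elements of $S_1$. *)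

theory Defs
  imports
    Complex_Main
    "HOL-Library.Poly_Mapping"
    "HOL-Library.Set_Algebras"
    "HOL-Computational_Algebra.Group_Closure"
begin

text \<open>The library hides the short names of these constants.\<close>

abbreviation lookup :: "('a \<Rightarrow>\<^sub>0 'b::zero) \<Rightarrow> 'a \<Rightarrow> 'b" where
  "lookup \<equiv> Poly_Mapping.lookup"

abbreviation keys :: "('a \<Rightarrow>\<^sub>0 'b::zero) \<Rightarrow> 'a set" where
  "keys \<equiv> Poly_Mapping.keys"

section \<open>Graded rings\<close>

text \<open>
  A nonnegatively graded ring is given by the family of its homogeneous components inside an
  ambient commutative ring.  The elements of the external direct sum of a family \<open>A\<close> are the
  finitely supported \<open>f\<close> with \<open>f m \<in> A m\<close> for all \<open>m\<close>; the ring \<open>T\<close> is the internal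
  direct sum of \<open>A\<close> if summation maps the external direct sum bijectively onto \<open>T\<close>.
\<close>

definition external_sum :: "(nat \<Rightarrow> 'a::zero set) \<Rightarrow> (nat \<Rightarrow>\<^sub>0 'a) set" where
  "external_sum A = {f. \<forall>m. lookup f m \<in> A m}"

definition family_sum :: "(nat \<Rightarrow>\<^sub>0 'a::comm_monoid_add) \<Rightarrow> 'a" where
  "family_sum f = (\<Sum>m\<in>keys f. lookup f m)"

definition is_direct_sum :: "'a::comm_monoid_add set \<Rightarrow> (nat \<Rightarrow> 'a set) \<Rightarrow> bool" where
  "is_direct_sum T A \<longleftrightarrow> bij_betw family_sum (external_sum A) T"

definition graded_total :: "(nat \<Rightarrow> 'a::comm_monoid_add set) \<Rightarrow> 'a set" where
  "graded_total S = family_sum ` external_sum S"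

definition graded_ring :: "(nat \<Rightarrow> 'a::comm_ring_1 set) \<Rightarrow> bool" where
  "graded_ring S \<longleftrightarrow>
     (\<forall>m. group_closure (S m) = S m) \<and>
     1 \<in> S 0 \<and>
     (\<forall>i j. \<forall>a\<in>S i. \<forall>b\<in>S j. a * b \<in> S (i + j)) \<and>
     is_direct_sum (graded_total S) S"

definition veronese :: "nat \<Rightarrow> (nat \<Rightarrow> 'a set) \<Rightarrow> (nat \<Rightarrow> 'a set)" where
  "veronese r S = (\<lambda>m. S (r * m))"

text \<open>
  The additive subgroup generated by \<open>m\<close>-fold products of elements of \<open>A\<close>
  (not the elementwise power of a set).
\<close>

definition power_group :: "'a::comm_ring_1 set \<Rightarrow> nat \<Rightarrow> 'a set" where
  "power_group A m = group_closure {\<Prod>i=1..m. a i | a. \<forall>i\<in>{1..m}. a i \<in> A}"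

definition generated_in_degree_1 :: "(nat \<Rightarrow> 'a::comm_ring_1 set) \<Rightarrow> bool" where
  "generated_in_degree_1 S \<longleftrightarrow>
     is_direct_sum (graded_total S) (\<lambda>m. if m = 0 then S 0 else power_group (S 1) m)"

section \<open>Weighted polynomial rings\<close>

text \<open>
  The coordinates are indexed by a finite type \<open>'n\<close>, so \<open>n = CARD('n) \<ge> 1\<close>.
  The order that the library puts on \<open>'n \<Rightarrow>\<^sub>0 nat\<close> is lexicographic, hence the separate
  componentwise order below.
\<close>

type_synonym 'n natvec = "'n \<Rightarrow>\<^sub>0 nat"

definition dot :: "'n::finite natvec \<Rightarrow> 'n natvec \<Rightarrow> nat" (infixl \<open>\<cdot>\<close> 70) where
  "a \<cdot> b = (\<Sum>i\<in>UNIV. lookup a i * lookup b i)"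

definition vec_le :: "'n natvec \<Rightarrow> 'n natvec \<Rightarrow> bool" (infix \<open>\<preceq>\<close> 50) where
  "a \<preceq> b \<longleftrightarrow> (\<forall>i. lookup a i \<le> lookup b i)"

definition wlcm :: "'n::finite natvec \<Rightarrow> nat" where
  "wlcm w = Lcm (range (lookup w))"

text \<open>
  The polynomial ring \<open>Q[x\<^sub>1, \<dots>, x\<^sub>n]\<close> is the type \<open>'n natvec \<Rightarrow>\<^sub>0 'q\<close> with the convolution product;
  \<open>Poly_Mapping.single v c\<close> is the term \<open>c x\<^sup>v\<close>, of degree \<open>w \<cdot> v\<close>.
\<close>

definition weighted_poly :: "'n::finite natvec \<Rightarrow> nat \<Rightarrow> ('n natvec \<Rightarrow>\<^sub>0 'q::comm_ring_1) set" where
  "weighted_poly w m = {p. \<forall>v\<in>keys p. w \<cdot> v = m}"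

section \<open>Bubbles\<close>

definition V :: "'n::finite natvec \<Rightarrow> nat \<Rightarrow> 'n natvec set" where
  "V w m = {v. w \<cdot> v = m}"

definition Vplus :: "'n::finite natvec \<Rightarrow> nat \<Rightarrow> 'n natvec set" where
  "Vplus w m = {v. w \<cdot> v \<ge> m}"

text \<open>The sum is taken in the library's addition of sets, i.e. Minkowski addition.\<close>

definition minkowski_multiple :: "nat \<Rightarrow> 'n natvec set \<Rightarrow> 'n natvec set" where
  "minkowski_multiple m S = (\<Sum>i=1..m. S)"

definition bubble :: "'n::finite natvec \<Rightarrow> 'n natvec \<Rightarrow> bool" where
  "bubble w u \<longleftrightarrow> w \<cdot> u \<ge> 2 * wlcm w \<and> \<not> (\<exists>v. w \<cdot> v = wlcm w \<and> v \<preceq> u)"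

text \<open>
  Here \<open>q = \<lfloor>w \<cdot> u / d\<rfloor>\<close> is natural number division, and the subtraction in \<open>r = m k - q\<close>
  does not truncate for \<open>k \<ge> 1\<close>, because \<open>m \<ge> q / k\<close>.
\<close>

definition bubble_condition :: "'n::finite natvec \<Rightarrow> 'n natvec \<Rightarrow> nat \<Rightarrow> bool" where
  "bubble_condition w u k \<longleftrightarrow>
     (let q = (w \<cdot> u) div wlcm w;
          m = max 1 (nat \<lceil>real q / real k\<rceil>);
          r = m * k - q
      in \<exists>v :: nat \<Rightarrow> 'n natvec. (\<forall>i\<in>{1..r}. v i \<in> V w (wlcm w)) \<and>
           u + (\<Sum>i=1..r. v i) \<notin> minkowski_multiple m (Vplus w (k * wlcm w)))"

section \<open>The gradings in use are gradings\<close>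

lemma dot_zero [simp]: "w \<cdot> 0 = 0"
  by (simp add: dot_def)

lemma dot_add: "w \<cdot> (a + b) = w \<cdot> a + w \<cdot> b"
  by (simp add: dot_def lookup_add algebra_simps sum.distrib)

lemma group_closure_eqI:
  fixes S :: "'a::ab_group_add set"
  assumes "0 \<in> S" "\<And>a b. a \<in> S \<Longrightarrow> b \<in> S \<Longrightarrow> a - b \<in> S"
  shows "group_closure S = S"
proof
  show "group_closure S \<subseteq> S"
  proof
    fix x assume "x \<in> group_closure S"
    then show "x \<in> S" by induction (use assms in auto)
  qed
  show "S \<subseteq> group_closure S" by (auto intro: group_closure.base)
qed

lemma lookup_family_sum_weighted_poly:
  fixes f :: "nat \<Rightarrow>\<^sub>0 ('n::finite natvec \<Rightarrow>\<^sub>0 'q::comm_ring_1)"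
  assumes "f \<in> external_sum (weighted_poly w)"
  shows "lookup (family_sum f) v = lookup (lookup f (w \<cdot> v)) v"
proof -
  have z: "lookup (lookup f m) v = 0" if "m \<noteq> w \<cdot> v" for m
  proof -
    have "v \<notin> keys (lookup f m)"
      using assms that by (auto simp: external_sum_def weighted_poly_def)
    then show ?thesis by (simp add: in_keys_iff)
  qed
  have "lookup (family_sum f) v = (\<Sum>m\<in>keys f. lookup (lookup f m) v)"
    by (simp add: family_sum_def lookup_sum)
  also have "\<dots> = (\<Sum>m\<in>insert (w \<cdot> v) (keys f). lookup (lookup f m) v)"
    by (rule sum.mono_neutral_left) (auto simp: in_keys_iff)
  also have "\<dots> = (\<Sum>m\<in>{w \<cdot> v}. lookup (lookup f m) v)"
    by (rule sum.mono_neutral_right) (auto simp: z)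
  finally show ?thesis by simp
qed

lemma weighted_poly_direct_sum:
  fixes w :: "'n::finite natvec"
  shows "is_direct_sum (UNIV :: ('n natvec \<Rightarrow>\<^sub>0 'q::comm_ring_1) set) (weighted_poly w)"
  unfolding is_direct_sum_def bij_betw_def
proof
  let ?E = "external_sum (weighted_poly w) :: (nat \<Rightarrow>\<^sub>0 ('n natvec \<Rightarrow>\<^sub>0 'q)) set"
  show "inj_on family_sum ?E"
  proof (rule inj_onI)
    fix f g assume f: "f \<in> ?E" and g: "g \<in> ?E" and eq: "family_sum f = family_sum g"
    have "lookup (lookup f m) v = lookup (lookup g m) v" for m v
    proof (cases "m = w \<cdot> v")
      case True
      then show ?thesis
        using lookup_family_sum_weighted_poly[OF f] lookup_family_sum_weighted_poly[OF g] eq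
        by metis
    next
      case False
      then have "v \<notin> keys (lookup f m)" "v \<notin> keys (lookup g m)"
        using f g by (auto simp: external_sum_def weighted_poly_def)
      then show ?thesis by (simp add: in_keys_iff)
    qed
    then show "f = g" by (intro poly_mapping_eqI) auto
  qed
  show "family_sum ` ?E = UNIV"
  proof (intro equalityI subsetI)
    fix p :: "'n natvec \<Rightarrow>\<^sub>0 'q"
    define c where "c m = Abs_poly_mapping (\<lambda>v. lookup p v when w \<cdot> v = m)" for m
    have fin: "finite {v. (lookup p v when w \<cdot> v = m) \<noteq> 0}" for m
      by (rule finite_subset[OF _ finite_lookup[of p]]) auto
    have lc: "lookup (c m) v = (lookup p v when w \<cdot> v = m)" for m v
      unfolding c_def using fin by simp
    have "{m. c m \<noteq> 0} \<subseteq> (\<lambda>v. w \<cdot> v) ` keys p"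
    proof
      fix m assume "m \<in> {m. c m \<noteq> 0}"
      then obtain v where "lookup (c m) v \<noteq> 0"
        by (auto simp: poly_mapping_eq_iff fun_eq_iff)
      then show "m \<in> (\<lambda>v. w \<cdot> v) ` keys p" by (auto simp: lc in_keys_iff)
    qed
    then have "finite {m. c m \<noteq> 0}" by (rule finite_subset) simp
    then have lf: "lookup (Abs_poly_mapping c) m = c m" for m by simp
    have E: "Abs_poly_mapping c \<in> ?E"
      by (auto simp: external_sum_def weighted_poly_def lf in_keys_iff lc)
    have "family_sum (Abs_poly_mapping c) = p"
      by (rule poly_mapping_eqI) (simp add: lookup_family_sum_weighted_poly[OF E] lf lc)
    with E show "p \<in> family_sum ` ?E" by blast
  qed auto
qed

lemma graded_total_weighted_poly:
  fixes w :: "'n::finite natvec"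
  shows "graded_total (weighted_poly w) = (UNIV :: ('n natvec \<Rightarrow>\<^sub>0 'q::comm_ring_1) set)"
  using weighted_poly_direct_sum[of w, where 'q = 'q]
  by (simp add: is_direct_sum_def graded_total_def bij_betw_def)

lemma graded_ring_weighted_poly:
  fixes w :: "'n::finite natvec"
  shows "graded_ring (weighted_poly w :: nat \<Rightarrow> ('n natvec \<Rightarrow>\<^sub>0 'q::comm_ring_1) set)"
proof -
  let ?S = "weighted_poly w :: nat \<Rightarrow> ('n natvec \<Rightarrow>\<^sub>0 'q) set"
  have "a - b \<in> ?S m" if "a \<in> ?S m" "b \<in> ?S m" for a b m
  proof -
    have "v \<in> keys a \<or> v \<in> keys b" if "v \<in> keys (a - b)" for v
      using that by (auto simp: in_keys_iff lookup_minus)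
    then show ?thesis using that by (auto simp: weighted_poly_def)
  qed
  moreover have "0 \<in> ?S m" for m by (simp add: weighted_poly_def)
  ultimately have "group_closure (?S m) = ?S m" for m
    by (metis group_closure_eqI)
  moreover have "1 \<in> ?S 0" by (simp add: weighted_poly_def)
  moreover have "a * b \<in> ?S (i + j)" if "a \<in> ?S i" "b \<in> ?S j" for a b i j
  proof -
    have "w \<cdot> v = i + j" if v: "v \<in> keys (a * b)" for v
    proof -
      from keys_mult v obtain x y where "v = x + y" "x \<in> keys a" "y \<in> keys b" by blast
      with \<open>a \<in> ?S i\<close> \<open>b \<in> ?S j\<close> show ?thesis by (simp add: weighted_poly_def dot_add)
    qed
    then show ?thesis by (simp add: weighted_poly_def)
  qed
  ultimately show ?thesis
    using weighted_poly_direct_sum[of w, where 'q = 'q]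
    by (simp add: graded_ring_def graded_total_weighted_poly)
qed

lemma graded_ring_veronese:
  fixes S :: "nat \<Rightarrow> 'a::comm_ring_1 set"
  assumes S: "graded_ring S" and r: "r \<ge> 1"
  shows "graded_ring (veronese r S)"
proof -
  have zero: "0 \<in> S m" for m
    using S zero_in_group_closure[of "S m"] by (simp add: graded_ring_def)
  have inj: "inj_on family_sum (external_sum S)"
    using S by (simp add: graded_ring_def is_direct_sum_def bij_betw_def)
  define e :: "(nat \<Rightarrow>\<^sub>0 'a) \<Rightarrow> nat \<Rightarrow>\<^sub>0 'a"
    where "e f = Abs_poly_mapping (\<lambda>m. lookup f (m div r) when r dvd m)" for f
  have le: "lookup (e f) m = (lookup f (m div r) when r dvd m)" for f m
  proof -
    have "{m. (lookup f (m div r) when r dvd m) \<noteq> 0} \<subseteq> (\<lambda>m. r * m) ` keys f"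
      using r by (auto simp: in_keys_iff elim!: dvdE)
    then have "finite {m. (lookup f (m div r) when r dvd m) \<noteq> 0}"
      by (rule finite_subset) simp
    then show ?thesis by (simp add: e_def)
  qed
  have e_in: "e f \<in> external_sum S" if "f \<in> external_sum (veronese r S)" for f
    using that r zero
    by (auto simp: external_sum_def veronese_def le when_def elim!: dvdE)
  have e_sum: "family_sum (e f) = family_sum f" for f
  proof -
    have "keys (e f) = (\<lambda>m. r * m) ` keys f"
      using r by (auto simp: in_keys_iff le elim!: dvdE)
    moreover have "inj_on (\<lambda>m. r * m) (keys f)" using r by (auto simp: inj_on_def)
    ultimately show ?thesis
      using r by (simp add: family_sum_def sum.reindex le)
  qed
  have e_inj: "f = g" if "e f = e g" for f g
  proof (rule poly_mapping_eqI)
    fix m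
    show "lookup f m = lookup g m"
      using le[of f "r * m"] le[of g "r * m"] that r by simp
  qed
  have "inj_on family_sum (external_sum (veronese r S))"
    using inj e_in e_sum e_inj by (metis inj_on_def)
  then have "is_direct_sum (graded_total (veronese r S)) (veronese r S)"
    by (simp add: is_direct_sum_def graded_total_def bij_betw_def)
  moreover have "a * b \<in> veronese r S (i + j)"
    if "a \<in> veronese r S i" "b \<in> veronese r S j" for a b i j
    using S that by (simp add: graded_ring_def veronese_def distrib_left)
  moreover have "group_closure (veronese r S m) = veronese r S m" for m
    using S by (simp add: graded_ring_def veronese_def)
  moreover have "1 \<in> veronese r S 0"
    using S by (simp add: graded_ring_def veronese_def)
  ultimately show ?thesis by (simp add: graded_ring_def)
qed

end

theory Submission
  imports Defs
begin

text \<open>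
  A graded ring is generated in degree 1 iff each component is spanned by products of elements of
  degree 1; for a Veronese subring of a weighted polynomial ring this says that every monomial of
  degree \<open>m k d\<close> is a product of \<open>m\<close> monomials of degree \<open>k d\<close>.  Removing vectors of weight \<open>d\<close>
  greedily from an exponent that violates this leaves a bubble \<open>u\<close>, as otherwise the exponent
  would be a sum of \<open>m k\<close> vectors of weight \<open>d\<close>.  Putting back just enough of the removed vectors
  to reach a multiple of \<open>k d\<close> gives an indecomposable exponent, because the vectors that remain
  can be grouped \<open>k\<close> at a time.
\<close>

section \<open>Additive subgroups generated by a set\<close>

lemma group_closure_subset:
  assumes "A \<subseteq> B" "group_closure B = B"
  shows "group_closure A \<subseteq> B"
proof
  fix x assume "x \<in> group_closure A"
  then show "x \<in> B"
  proof induction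
    \<comment> \<open>The generators of \<open>group_closure\<close> include 0, so 0 must be found
      in \<open>B\<close> as well.\<close>
    case (base s)
    then show ?case using assms zero_in_group_closure[of B] by auto
  next
    case diff
    then show ?case using assms(2) by (metis group_closure.diff)
  qed
qed

lemma sum_in_group_closure:
  assumes "\<And>i. i \<in> I \<Longrightarrow> f i \<in> group_closure A"
  shows "sum f I \<in> group_closure A"
  using assms by (induction I rule: infinite_finite_induct) (auto intro: group_closure_add)

section \<open>Generation in degree 1\<close>

lemma graded_ring_prod_in:
  fixes S :: "nat \<Rightarrow> 'a::comm_ring_1 set"
  assumes "graded_ring S" "\<forall>i\<in>{1..m}. a i \<in> S 1"
  shows "(\<Prod>i=1..m. a i) \<in> S m"
  using assms(2)
proof (induction m)
  case 0
  then show ?case using assms(1) by (simp add: graded_ring_def)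
next
  case (Suc m)
  then have "(\<Prod>i=1..m. a i) \<in> S m" "a (Suc m) \<in> S 1" by simp_all
  then have "(\<Prod>i=1..m. a i) * a (Suc m) \<in> S (m + 1)"
    using assms(1) unfolding graded_ring_def by blast
  then show ?case by simp
qed

lemma power_group_subset:
  assumes "graded_ring S"
  shows "power_group (S 1) m \<subseteq> S m"
  unfolding power_group_def
  using assms graded_ring_prod_in[OF assms]
  by (intro group_closure_subset) (auto simp: graded_ring_def)

lemma single_in_external_sum:
  "\<lbrakk>\<And>m. 0 \<in> A m; a \<in> A m\<rbrakk> \<Longrightarrow> Poly_Mapping.single m a \<in> external_sum A"
  by (auto simp: external_sum_def lookup_single when_def)

text \<open>Powers of \<open>S 1\<close> lie in the components of \<open>S\<close>, so the external
  sum of powers is contained in that of \<open>S\<close>. Summation is injective on the larger one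
  and both have the same image, so they coincide.\<close>

lemma generated_in_degree_1_iff:
  assumes S: "graded_ring S"
  shows "generated_in_degree_1 S \<longleftrightarrow> (\<forall>m\<ge>1. S m \<subseteq> power_group (S 1) m)"
proof
  let ?G = "\<lambda>m. if m = 0 then S 0 else power_group (S 1) m"
  assume gen: "generated_in_degree_1 S"
  have "?G m \<subseteq> S m" for m
    using power_group_subset[OF S] by simp
  then have sub: "external_sum ?G \<subseteq> external_sum S"
    unfolding external_sum_def by blast
  have "inj_on family_sum (external_sum S)"
    using S by (simp add: graded_ring_def is_direct_sum_def bij_betw_def)
  moreover have "family_sum ` external_sum ?G = family_sum ` external_sum S"
    using gen by (simp add: generated_in_degree_1_def is_direct_sum_def bij_betw_def
        graded_total_def)
  ultimately have eq: "external_sum ?G = external_sum S"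
    using sub by (metis inj_on_image_eq_iff subset_refl)
  have zero: "0 \<in> S m" for m
    using S zero_in_group_closure[of "S m"] by (simp add: graded_ring_def)
  have "a \<in> ?G m" if "a \<in> S m" for a m
  proof -
    \<comment> \<open>Equality of the external sums passes to components by placing \<open>a\<close>
      alone in degree \<open>m\<close>.\<close>
    have "Poly_Mapping.single m a \<in> external_sum ?G"
      using single_in_external_sum[of S a m] zero that eq by simp
    then have "lookup (Poly_Mapping.single m a) m \<in> ?G m"
      unfolding external_sum_def by blast
    then show ?thesis by simp
  qed
  then show "\<forall>m\<ge>1. S m \<subseteq> power_group (S 1) m"
    by (metis not_one_le_zero subsetI)
next
  assume "\<forall>m\<ge>1. S m \<subseteq> power_group (S 1) m"
  then have "power_group (S 1) m = S m" if "m \<noteq> 0" for m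
    using that power_group_subset[OF S, of m] by (simp add: subset_antisym)
  then have "(\<lambda>m. if m = 0 then S 0 else power_group (S 1) m) = S"
    by (intro ext) simp
  then show "generated_in_degree_1 S"
    using S by (simp add: generated_in_degree_1_def graded_ring_def)
qed

section \<open>Monomials\<close>

lemma minkowski_multiple_0: "minkowski_multiple 0 S = {0}"
  by (simp add: minkowski_multiple_def)

lemma minkowski_multiple_Suc: "minkowski_multiple (Suc m) S = minkowski_multiple m S + S"
  by (simp add: minkowski_multiple_def)

lemma minkowski_multiple_add:
  "minkowski_multiple (m + n) S = minkowski_multiple m S + minkowski_multiple n S"
  by (induction n) (simp_all add: minkowski_multiple_0 minkowski_multiple_Suc add.assoc
      flip: set_zero)

lemma in_minkowski_multiple_iff:
  "x \<in> minkowski_multiple m S \<longleftrightarrow> (\<exists>s. (\<forall>i\<in>{1..m}. s i \<in> S) \<and> x = (\<Sum>i=1..m. s i))"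
  by (auto simp: minkowski_multiple_def set_sum_alt)

lemma dot_sum: "w \<cdot> (\<Sum>i\<in>I. v i) = (\<Sum>i\<in>I. w \<cdot> v i)"
  by (induction I rule: infinite_finite_induct) (simp_all add: dot_add)

text \<open>Exponents of a product are sums of exponents of the factors; cancellation can only
  remove some.\<close>

lemma keys_prod_weighted_poly:
  assumes "\<forall>i\<in>{1..m}. a i \<in> weighted_poly w d"
  shows "keys (\<Prod>i=1..m. a i) \<subseteq> minkowski_multiple m (V w d)"
  using assms
proof (induction m)
  case (Suc m)
  then have "keys (\<Prod>i=1..m. a i) \<subseteq> minkowski_multiple m (V w d)" by simp
  moreover have "keys (a (Suc m)) \<subseteq> V w d"
    using Suc.prems by (auto simp: weighted_poly_def V_def)
  moreover have "(\<Prod>i=1..Suc m. a i) = (\<Prod>i=1..m. a i) * a (Suc m)" by simp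
  ultimately show ?case
    using keys_mult[of "\<Prod>i=1..m. a i" "a (Suc m)"]
    by (fastforce simp: minkowski_multiple_Suc set_plus_def)
qed (simp add: minkowski_multiple_0)

lemma keys_power_group_weighted_poly:
  assumes "p \<in> power_group (weighted_poly w d) m"
  shows "keys p \<subseteq> minkowski_multiple m (V w d)"
  using assms unfolding power_group_def
proof induction
  case (base p)
  then show ?case using keys_prod_weighted_poly by (fastforce simp del: One_nat_def)
next
  case (diff p q)
  moreover have "keys (p - q) \<subseteq> keys p \<union> keys q"
    by (auto simp: in_keys_iff lookup_minus)
  ultimately show ?case by blast
qed

lemma prod_single:
  "(\<Prod>i\<in>I. Poly_Mapping.single (s i) (1::'q::comm_ring_1)) =
     Poly_Mapping.single (\<Sum>i\<in>I. s i :: 'n natvec) 1"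
  by (induction I rule: infinite_finite_induct) (simp_all add: mult_single)

lemma single_in_power_group:
  assumes "v \<in> minkowski_multiple m (V w d)" "m \<ge> 1"
  shows "Poly_Mapping.single v (c::'q::comm_ring_1) \<in> power_group (weighted_poly w d) m"
proof -
  from assms(1) obtain s where s: "\<forall>i\<in>{1..m}. s i \<in> V w d" "v = (\<Sum>i=1..m. s i)"
    by (auto simp: in_minkowski_multiple_iff)
  \<comment> \<open>The first factor carries the whole coefficient \<open>c\<close>; it exists
    because \<open>m\<close> is positive.\<close>
  define a where "a i = Poly_Mapping.single (s i) (if i = 1 then c else 1)" for i
  have split: "{1..m} = insert 1 {2..m}" using assms(2) by auto
  have "(\<Prod>i\<in>{2..m}. a i) = Poly_Mapping.single (\<Sum>i=2..m. s i) 1"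
    unfolding prod_single[symmetric] by (rule prod.cong) (auto simp: a_def)
  then have "(\<Prod>i=1..m. a i) = Poly_Mapping.single v c"
    unfolding s(2) split by (simp add: a_def mult_single)
  moreover have "\<forall>i\<in>{1..m}. a i \<in> weighted_poly w d"
    using s(1) by (auto simp: weighted_poly_def a_def V_def split: if_splits)
  ultimately show ?thesis
    unfolding power_group_def by (intro group_closure.base insertI2 CollectI exI[of _ a]) simp
qed

lemma poly_mapping_eq_sum_single:
  "p = (\<Sum>v\<in>keys p. Poly_Mapping.single v (lookup p v))"
  by (rule poly_mapping_eqI)
    (auto simp: lookup_sum lookup_single when_def in_keys_iff if_distrib cong: if_cong)

text \<open>Here the coefficient ring disappears: what remains is a statement about
  exponents.\<close>

lemma weighted_poly_subset_power_group_iff: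
  assumes "m \<ge> 1"
  shows "(weighted_poly w e :: ('n::finite natvec \<Rightarrow>\<^sub>0 'q::comm_ring_1) set)
           \<subseteq> power_group (weighted_poly w d) m
         \<longleftrightarrow> V w e \<subseteq> minkowski_multiple m (V w d)"
proof
  assume sub: "(weighted_poly w e :: ('n natvec \<Rightarrow>\<^sub>0 'q) set)
    \<subseteq> power_group (weighted_poly w d) m"
  show "V w e \<subseteq> minkowski_multiple m (V w d)"
  proof
    fix v assume "v \<in> V w e"
    \<comment> \<open>The coefficient 1 is nonzero in \<open>'q\<close>, so \<open>keys\<close>
      recovers the exponent \<open>v\<close>.\<close>
    then have "Poly_Mapping.single v (1::'q) \<in> weighted_poly w e"
      by (simp add: weighted_poly_def V_def)
    with sub keys_power_group_weighted_poly
    have "keys (Poly_Mapping.single v (1::'q)) \<subseteq> minkowski_multiple m (V w d)" by blast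
    then show "v \<in> minkowski_multiple m (V w d)" by simp
  qed
next
  assume sub: "V w e \<subseteq> minkowski_multiple m (V w d)"
  show "(weighted_poly w e :: ('n natvec \<Rightarrow>\<^sub>0 'q) set) \<subseteq> power_group (weighted_poly w d) m"
  proof
    fix p :: "'n natvec \<Rightarrow>\<^sub>0 'q" assume p: "p \<in> weighted_poly w e"
    have "(\<Sum>v\<in>keys p. Poly_Mapping.single v (lookup p v)) \<in> power_group (weighted_poly w d) m"
      unfolding power_group_def
    proof (rule sum_in_group_closure, fold power_group_def)
      fix v assume "v \<in> keys p"
      then have "v \<in> V w e" using p by (simp add: weighted_poly_def V_def)
      then show "Poly_Mapping.single v (lookup p v) \<in> power_group (weighted_poly w d) m"
        using sub assms by (intro single_in_power_group) auto
    qed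
    then show "p \<in> power_group (weighted_poly w d) m"
      using poly_mapping_eq_sum_single[of p] by simp
  qed
qed

section \<open>Bubbles\<close>

text \<open>The summands have weight at least \<open>e\<close> and total weight \<open>m e\<close>, so each has weight exactly \<open>e\<close>.\<close>

lemma minkowski_multiple_Vplus_iff:
  assumes "w \<cdot> x = m * e"
  shows "x \<in> minkowski_multiple m (Vplus w e) \<longleftrightarrow> x \<in> minkowski_multiple m (V w e)"
proof
  assume "x \<in> minkowski_multiple m (Vplus w e)"
  then obtain s where s: "\<forall>i\<in>{1..m}. e \<le> w \<cdot> s i" "x = (\<Sum>i=1..m. s i)"
    by (auto simp: in_minkowski_multiple_iff Vplus_def)
  have "(\<Sum>i=1..m. e) = (\<Sum>i=1..m. w \<cdot> s i)"
    using assms by (simp add: s(2) dot_sum)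
  then have "w \<cdot> s i = e" if "i \<in> {1..m}" for i
    using sum_mono_inv[of "\<lambda>_. e" "{1..m}" "\<lambda>i. w \<cdot> s i"] s(1) that by simp
  then show "x \<in> minkowski_multiple m (V w e)"
    using s(2) unfolding in_minkowski_multiple_iff V_def by blast
qed (auto simp: in_minkowski_multiple_iff V_def Vplus_def)

text \<open>The index set splits into \<open>m\<close> blocks of size \<open>k\<close>, and each
  block sums to a vector of weight \<open>k * d\<close>.\<close>

lemma sum_V_in_minkowski_multiple:
  assumes "finite A" "card A = m * k" "\<forall>i\<in>A. v i \<in> V w d"
  shows "sum v A \<in> minkowski_multiple m (V w (k * d))"
  using assms
proof (induction m arbitrary: A)
  case (Suc m)
  then obtain B where B: "B \<subseteq> A" "card B = k" "finite B"
    using obtain_subset_with_card_n[of k A] by auto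
  have "sum v (A - B) \<in> minkowski_multiple m (V w (k * d))"
    using Suc B by (intro Suc.IH) (auto simp: card_Diff_subset)
  moreover have "(\<Sum>i\<in>B. w \<cdot> v i) = (\<Sum>i\<in>B. d)"
    using B(1) Suc.prems(3) by (intro sum.cong) (auto simp: V_def)
  then have "sum v B \<in> V w (k * d)"
    using B by (simp add: V_def dot_sum)
  ultimately show ?case
    using sum.subset_diff[OF B(1) Suc.prems(1), of v]
    by (auto simp: minkowski_multiple_Suc intro: set_plus_intro)
qed (simp add: minkowski_multiple_0)

lemma vec_le_imp_add:
  assumes "v \<preceq> x"
  obtains y where "x = y + v"
proof
  \<comment> \<open>The truncated subtraction is exact in each coordinate, as \<open>v\<close> lies
    below \<open>x\<close>.\<close>
  show "x = (x - v) + v"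
    using assms by (intro poly_mapping_eqI) (simp add: lookup_add lookup_minus vec_le_def)
qed

text \<open>Each removal lowers the weight by \<open>d > 0\<close>, so the process stops.\<close>

lemma greedy_decomposition:
  assumes "d > 0"
  shows "\<exists>u s v. x = u + (\<Sum>i=1..s. v i) \<and> (\<forall>i\<in>{1..s::nat}. v i \<in> V w d)
           \<and> \<not> (\<exists>v. w \<cdot> v = d \<and> v \<preceq> u)"
proof (induction "w \<cdot> x" arbitrary: x rule: less_induct)
  case less
  show ?case
  proof (cases "\<exists>v. w \<cdot> v = d \<and> v \<preceq> x")
    case False
    then show ?thesis by (intro exI[of _ x] exI[of _ 0]) simp
  next
    case True
    then obtain a y where a: "w \<cdot> a = d" "x = y + a" by (metis vec_le_imp_add)
    then have "w \<cdot> y < w \<cdot> x" using assms by (simp add: dot_add)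
    from less[OF this] obtain u v and s :: nat where usv: "y = u + (\<Sum>i=1..s. v i)"
      "\<forall>i\<in>{1..s}. v i \<in> V w d" "\<not> (\<exists>v. w \<cdot> v = d \<and> v \<preceq> u)" by blast
    have "(\<Sum>i=1..s. (v(Suc s := a)) i) = (\<Sum>i=1..s. v i)" by (rule sum.cong) auto
    then have "x = u + (\<Sum>i=1..Suc s. (v(Suc s := a)) i)"
      using a(2) usv(1) by (simp add: add.assoc)
    moreover have "\<forall>i\<in>{1..Suc s}. (v(Suc s := a)) i \<in> V w d"
      using usv(2) a(1) by (auto simp: V_def)
    ultimately show ?thesis using usv(3) by blast
  qed
qed

lemma dot_eq_0_iff:
  assumes "\<forall>i. lookup w i \<ge> 1"
  shows "w \<cdot> u = 0 \<longleftrightarrow> u = 0"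
proof
  assume "w \<cdot> u = 0"
  then have "lookup w i * lookup u i = 0" for i by (simp add: dot_def)
  moreover have "lookup w i \<noteq> 0" for i using assms by (metis not_one_le_zero)
  ultimately show "u = 0" by (intro poly_mapping_eqI) simp
qed simp

text \<open>The ceiling is the least \<open>m\<close> with \<open>q \<le> m * k\<close>. This gives
  both that \<open>m * k - q\<close> does not truncate and that the \<open>m\<close> of the bubble
  condition is minimal.\<close>

lemma nat_ceiling_divide_le_iff:
  assumes "k \<ge> 1"
  shows "nat \<lceil>real q / real k\<rceil> \<le> m \<longleftrightarrow> q \<le> m * k"
proof -
  have "nat \<lceil>real q / real k\<rceil> \<le> m \<longleftrightarrow> real q \<le> real (m * k)"
    using assms by (simp add: nat_le_iff ceiling_le_iff divide_le_eq)
  then show ?thesis by (simp only: of_nat_le_iff)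
qed

section \<open>Bubbles and indecomposable exponents\<close>

lemma bubble_condition_imp_not_subset:
  assumes "wlcm w dvd w \<cdot> u" "bubble_condition w u k" "k \<ge> 1" "wlcm w > 0"
  shows "\<exists>m\<ge>1. \<not> V w (m * (k * wlcm w)) \<subseteq> minkowski_multiple m (V w (k * wlcm w))"
proof -
  define d where "d = wlcm w"
  define q where "q = (w \<cdot> u) div d"
  define m where "m = max 1 (nat \<lceil>real q / real k\<rceil>)"
  define r where "r = m * k - q"
  from assms(2) obtain v where v: "\<forall>i\<in>{1..r}. v i \<in> V w d"
    "u + (\<Sum>i=1..r. v i) \<notin> minkowski_multiple m (Vplus w (k * d))"
    unfolding bubble_condition_def Let_def d_def q_def m_def r_def by blast
  have "q \<le> m * k"
    using nat_ceiling_divide_le_iff[OF assms(3), of q m] by (simp add: m_def)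
  moreover have "w \<cdot> u = q * d" using assms(1) by (simp add: q_def d_def)
  moreover have "(\<Sum>i=1..r. w \<cdot> v i) = r * d" using v(1) by (simp add: V_def)
  \<comment> \<open>The weights \<open>q * d\<close> and \<open>r * d\<close> add up to exactly
    \<open>m * (k * d)\<close>, the case in which \<open>Vplus\<close> may be replaced by
    \<open>V\<close>.\<close>
  ultimately have "w \<cdot> (u + (\<Sum>i=1..r. v i)) = m * (k * d)"
    by (simp add: dot_add dot_sum r_def flip: distrib_right mult.assoc)
  with v(2) have "\<not> V w (m * (k * d)) \<subseteq> minkowski_multiple m (V w (k * d))"
    by (auto simp: minkowski_multiple_Vplus_iff V_def)
  moreover have "m \<ge> 1" by (simp add: m_def)
  ultimately show ?thesis unfolding d_def by blast
qed

lemma not_subset_imp_bubble: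
  assumes pos: "\<forall>i. lookup w i \<ge> 1" and k: "k \<ge> 1" and d0: "wlcm w > 0" and M: "M \<ge> 1"
    and x: "x \<in> V w (M * (k * wlcm w))" "x \<notin> minkowski_multiple M (V w (k * wlcm w))"
  shows "\<exists>u. bubble w u \<and> wlcm w dvd w \<cdot> u \<and> bubble_condition w u k"
proof -
  define d where "d = wlcm w"
  have "d > 0" using d0 by (simp add: d_def)
  from greedy_decomposition[OF this, of x w] obtain u v and s :: nat
    where usv: "x = u + (\<Sum>i=1..s. v i)" "\<forall>i\<in>{1..s}. v i \<in> V w d"
      "\<not> (\<exists>v. w \<cdot> v = d \<and> v \<preceq> u)"
    by blast
  define q where "q = (w \<cdot> u) div d"
  define m where "m = max 1 (nat \<lceil>real q / real k\<rceil>)"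
  define r where "r = m * k - q"
  have "(\<Sum>i=1..s. w \<cdot> v i) = s * d" using usv(2) by (simp add: V_def)
  then have deg: "w \<cdot> u + s * d = (M * k) * d"
    using x(1) by (simp add: usv(1) V_def dot_add dot_sum d_def mult.assoc)
  then have dvd: "d dvd w \<cdot> u"
    by (metis dvd_add_left_iff dvd_triv_right)
  then have wu: "w \<cdot> u = q * d" by (simp add: q_def)
  with deg have qs: "q + s = M * k"
    using \<open>d > 0\<close> by (simp flip: distrib_right)
  \<comment> \<open>If \<open>q\<close> were 0, then \<open>u\<close> would vanish and
    \<open>x\<close> would be a sum of \<open>M * k\<close> vectors of weight
    \<open>d\<close>.\<close>
  have "q \<noteq> 0"
  proof
    assume "q = 0"
    then have "u = 0" using wu dot_eq_0_iff[OF pos] by simp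
    then have "x \<in> minkowski_multiple M (V w (k * d))"
      using usv(1,2) qs \<open>q = 0\<close> by (auto intro: sum_V_in_minkowski_multiple)
    with x(2) show False by (simp add: d_def)
  qed
  \<comment> \<open>If \<open>q\<close> were 1, then \<open>u\<close> itself would be a vector of
    weight \<open>d\<close> below \<open>u\<close>.\<close>
  moreover have "q \<noteq> 1"
    using usv(3) wu by (auto simp: vec_le_def)
  ultimately have bubble: "bubble w u"
    using usv(3) wu by (simp add: bubble_def d_def)
  have qm: "q \<le> m * k"
    using nat_ceiling_divide_le_iff[OF k, of q m] by (simp add: m_def)
  \<comment> \<open>\<open>M\<close> is positive and satisfies \<open>q \<le> M * k\<close>, and
    \<open>m\<close> is the least such number.\<close>
  have mM: "m \<le> M"
    using nat_ceiling_divide_le_iff[OF k, of q M] qs M by (simp add: m_def)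
  have "r + (M - m) * k = s"
    using qs qm mM mult_le_mono1[OF mM, of k] by (simp add: r_def diff_mult_distrib)
  then have rs: "r \<le> s" "card {r+1..s} = (M - m) * k" by auto
  \<comment> \<open>The first \<open>r\<close> removed vectors witness the condition: if they
    completed \<open>u\<close> to a decomposable exponent, the other \<open>(M - m) * k\<close>
    would supply the missing \<open>M - m\<close> summands of \<open>x\<close>.\<close>
  have "u + (\<Sum>i=1..r. v i) \<notin> minkowski_multiple m (Vplus w (k * d))"
  proof
    assume *: "u + (\<Sum>i=1..r. v i) \<in> minkowski_multiple m (Vplus w (k * d))"
    have "(\<Sum>i=1..r. w \<cdot> v i) = r * d" using usv(2) rs(1) by (simp add: V_def)
    then have "w \<cdot> (u + (\<Sum>i=1..r. v i)) = m * (k * d)"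
      using wu qm by (simp add: dot_add dot_sum r_def flip: distrib_right mult.assoc)
    with * have "u + (\<Sum>i=1..r. v i) \<in> minkowski_multiple m (V w (k * d))"
      by (simp add: minkowski_multiple_Vplus_iff)
    moreover have "(\<Sum>i=r+1..s. v i) \<in> minkowski_multiple (M - m) (V w (k * d))"
      using rs(2) usv(2) by (intro sum_V_in_minkowski_multiple) auto
    moreover have "{1..s} = {1..r} \<union> {r+1..s}" using rs(1) by auto
    then have "(\<Sum>i=1..s. v i) = (\<Sum>i=1..r. v i) + (\<Sum>i=r+1..s. v i)"
      by (simp add: sum.union_disjoint)
    then have "x = (u + (\<Sum>i=1..r. v i)) + (\<Sum>i=r+1..s. v i)"
      using usv(1) by (simp add: add.assoc)
    ultimately have "x \<in> minkowski_multiple (m + (M - m)) (V w (k * d))"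
      unfolding minkowski_multiple_add by (metis set_plus_intro)
    with x(2) mM show False by (simp add: d_def)
  qed
  moreover have "\<forall>i\<in>{1..r}. v i \<in> V w d" using usv(2) rs(1) by auto
  ultimately have "bubble_condition w u k"
    unfolding bubble_condition_def Let_def m_def r_def q_def d_def by blast
  with bubble dvd show ?thesis unfolding d_def by blast
qed

theorem proposition2p5:
  fixes w :: "'n::finite natvec" and k :: nat
  assumes "\<forall>i. lookup w i \<ge> 1" and "k \<ge> 1"
  shows "generated_in_degree_1
           (veronese (k * wlcm w)
              (weighted_poly w :: nat \<Rightarrow> ('n natvec \<Rightarrow>\<^sub>0 'q::comm_ring_1) set))
         \<longleftrightarrow> \<not> (\<exists>u. bubble w u \<and> wlcm w dvd w \<cdot> u \<and> bubble_condition w u k)"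
proof -
  \<comment> \<open>The least common multiple of finitely many numbers is 0 only if one of them
    is.\<close>
  have "0 \<notin> range (lookup w)" using assms(1) by (metis imageE not_one_le_zero)
  then have d: "wlcm w > 0" by (simp add: wlcm_def Lcm_0_iff zero_less_iff_neq_zero)
  then have "graded_ring (veronese (k * wlcm w)
      (weighted_poly w :: nat \<Rightarrow> ('n natvec \<Rightarrow>\<^sub>0 'q) set))"
    using assms(2) by (intro graded_ring_veronese graded_ring_weighted_poly) simp
  then have "generated_in_degree_1 (veronese (k * wlcm w)
      (weighted_poly w :: nat \<Rightarrow> ('n natvec \<Rightarrow>\<^sub>0 'q) set)) \<longleftrightarrow>
    (\<forall>m\<ge>1. V w (m * (k * wlcm w)) \<subseteq> minkowski_multiple m (V w (k * wlcm w)))"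
    by (simp add: generated_in_degree_1_iff veronese_def weighted_poly_subset_power_group_iff
        mult.commute[of "k * wlcm w"])
  then show ?thesis
    using bubble_condition_imp_not_subset[OF _ _ assms(2) d]
      not_subset_imp_bubble[OF assms d] by blast
qed

end
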